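(* Let $A$ be a unital $C^*$-algebra. Then every finitely generated Hilbert $A$-module has the module Schur property. In particular, the Hilbert $A$-modules $A^n$, $n\in\mathbb N$, have the module Schur property.
   Context: Hilbert modules are right Hilbert $C^*$-modules, with $A$-valued inner product $\langle\cdot,\cdot\rangle$ that is $A$-linear in the second variable. A Hilbert $A$-module is finitely generated if there is a finite subset such that every element of the module is an $A$-linear combination of elements of this subset. $A^n$ carries the inner product $\langle (a_i),(b_i)\rangle=\sum_{i=1}^n a_i^*b_i$. For a Hilbert $A$-module $V$, the topology $\tau_{\widehat V}$ on $V$ is the locally convex topology generated by the seminorms $x\mapsto\|\langle z,x\rangle\|$, $z\in V$. A sequence $\{x_n\}$ in $V$ is called $\tau_{\widehat V}$-convergent if for every $z\in V$ the sequence $\{\langle z,x_n\rangle\}$ converges in norm in $A$ (so the limit may lie in the completion of $V$ with respect to $\tau_{\widehat V}$, not necessarily in $V$). $V$ has the module Schur property if every $\tau_{\widehat V}$-convergent sequence in $V$ converges in norm (to an element of $V$). *)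

theory Defs
  imports "HOL-Analysis.Analysis" "HOL-Library.Nonpos_Ints"
begin

(* The unit comes from monoid_mult rather than ring_1, so that the zero algebra is not excluded. *)
class unital_cstar_algebra = real_normed_algebra + monoid_mult + banach +
  fixes scaleC :: "complex \<Rightarrow> 'a \<Rightarrow> 'a"  (infixr "*\<^sub>C" 75)
    and adj :: "'a \<Rightarrow> 'a"
  assumes scaleR_scaleC: "r *\<^sub>R x = complex_of_real r *\<^sub>C x"
    and scaleC_add_right: "c *\<^sub>C (x + y) = c *\<^sub>C x + c *\<^sub>C y"
    and scaleC_add_left: "(c + d) *\<^sub>C x = c *\<^sub>C x + d *\<^sub>C x"
    and scaleC_scaleC: "c *\<^sub>C d *\<^sub>C x = (c * d) *\<^sub>C x"
    and scaleC_one: "1 *\<^sub>C x = x"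
    and mult_scaleC_left: "(c *\<^sub>C x) * y = c *\<^sub>C (x * y)"
    and mult_scaleC_right: "x * (c *\<^sub>C y) = c *\<^sub>C (x * y)"
    and norm_scaleC: "norm (c *\<^sub>C x) = cmod c * norm x"
    and adj_add: "adj (x + y) = adj x + adj y"
    and adj_scaleC: "adj (c *\<^sub>C x) = cnj c *\<^sub>C adj x"
    and adj_mult: "adj (x * y) = adj y * adj x"
    and adj_adj: "adj (adj x) = x"
    and norm_adj_mult: "norm (adj x * x) = (norm x)\<^sup>2"

definition spectrum :: "'a::unital_cstar_algebra \<Rightarrow> complex set" where
  "spectrum a = {c. \<nexists>b. b * (c *\<^sub>C 1 - a) = 1 \<and> (c *\<^sub>C 1 - a) * b = 1}"

definition cstar_positive :: "'a::unital_cstar_algebra \<Rightarrow> bool" where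
  "cstar_positive a \<longleftrightarrow> adj a = a \<and> spectrum a \<subseteq> \<real>\<^sub>\<ge>\<^sub>0"

definition module_norm :: "('v \<Rightarrow> 'v \<Rightarrow> 'a::unital_cstar_algebra) \<Rightarrow> 'v \<Rightarrow> real" where
  "module_norm ip x = sqrt (norm (ip x x))"

definition module_norm_convergent ::
    "('v::ab_group_add \<Rightarrow> 'v \<Rightarrow> 'a::unital_cstar_algebra) \<Rightarrow> (nat \<Rightarrow> 'v) \<Rightarrow> bool" where
  "module_norm_convergent ip X \<longleftrightarrow> (\<exists>l. (\<lambda>n. module_norm ip (X n - l)) \<longlonglongrightarrow> 0)"

definition module_norm_Cauchy ::
    "('v::ab_group_add \<Rightarrow> 'v \<Rightarrow> 'a::unital_cstar_algebra) \<Rightarrow> (nat \<Rightarrow> 'v) \<Rightarrow> bool" where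
  "module_norm_Cauchy ip X \<longleftrightarrow>
     (\<forall>e>0. \<exists>N. \<forall>m\<ge>N. \<forall>n\<ge>N. module_norm ip (X m - X n) < e)"

locale hilbert_module = vector_space scale
  for scale :: "complex \<Rightarrow> 'v::ab_group_add \<Rightarrow> 'v" +
  fixes act :: "'v \<Rightarrow> 'a::unital_cstar_algebra \<Rightarrow> 'v"
    and ip :: "'v \<Rightarrow> 'v \<Rightarrow> 'a"
  assumes act_add_left: "act (x + y) a = act x a + act y a"
    and act_add_right: "act x (a + b) = act x a + act x b"
    and act_mult: "act x (a * b) = act (act x a) b"
    and act_one: "act x 1 = x"
    and act_scale_left: "act (scale c x) a = scale c (act x a)"
    and act_scaleC_right: "act x (c *\<^sub>C a) = scale c (act x a)"
    and ip_add_right: "ip x (y + z) = ip x y + ip x z"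
    and ip_scale_right: "ip x (scale c y) = c *\<^sub>C ip x y"
    and ip_act_right: "ip x (act y a) = ip x y * a"
    and adj_ip: "adj (ip x y) = ip y x"
    and ip_positive: "cstar_positive (ip x x)"
    and ip_definite: "ip x x = 0 \<Longrightarrow> x = 0"
    and complete: "module_norm_Cauchy ip X \<Longrightarrow> module_norm_convergent ip X"

definition finitely_generated ::
    "('v::ab_group_add \<Rightarrow> 'a::unital_cstar_algebra \<Rightarrow> 'v) \<Rightarrow> bool" where
  "finitely_generated act \<longleftrightarrow>
     (\<exists>S. finite S \<and> (\<forall>x. \<exists>a. x = (\<Sum>s\<in>S. act s (a s))))"

(* Convergence in the completion of the module for the locally convex topology generated by
   the seminorms norm (ip z x): the limit need not lie in the module itself. *)
definition tau_hat_convergent ::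
    "('v \<Rightarrow> 'v \<Rightarrow> 'a::unital_cstar_algebra) \<Rightarrow> (nat \<Rightarrow> 'v) \<Rightarrow> bool" where
  "tau_hat_convergent ip X \<longleftrightarrow> (\<forall>z. convergent (\<lambda>n. ip z (X n)))"

definition module_Schur ::
    "('v::ab_group_add \<Rightarrow> 'v \<Rightarrow> 'a::unital_cstar_algebra) \<Rightarrow> bool" where
  "module_Schur ip \<longleftrightarrow> (\<forall>X. tau_hat_convergent ip X \<longrightarrow> module_norm_convergent ip X)"

(* The standard module of n-tuples over the algebra, with n = CARD('n). Its norm as a Hilbert
   module is module_norm std_ip, which differs in general from the library norm on vectors. *)
definition std_scale :: "complex \<Rightarrow> ('a::unital_cstar_algebra)^'n \<Rightarrow> 'a^'n" where
  "std_scale c x = (\<chi> i. c *\<^sub>C x $ i)"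

definition std_act :: "('a::unital_cstar_algebra)^'n \<Rightarrow> 'a \<Rightarrow> 'a^'n" where
  "std_act x a = (\<chi> i. x $ i * a)"

definition std_ip :: "('a::unital_cstar_algebra)^'n \<Rightarrow> 'a^'n \<Rightarrow> 'a" where
  "std_ip x y = (\<Sum>i\<in>UNIV. adj (x $ i) * y $ i)"

end

(* Generators s in S norm the module: norm x <= C * (SUM s:S. norm (ip s x)). Otherwise there are
   unit vectors u_n with the right-hand sum at most 4^-n. Since every z is a combination of
   generators, norm (ip z u_n) = O(4^-n) for each z; but a gliding hump produces a z with
   norm (ip z u_n) >= 3^-n / 2 for all n. Hence weak convergence against S alone makes a sequence
   Cauchy in norm.

   The order structure needed for Cauchy-Schwarz and for the standard modules is derived from the
   spectral definition without Gelfand theory: a self-adjoint u with norm u <= t is positive iff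
   norm (t - u) <= t iff it is the square of a self-adjoint element, and square roots come from
   an explicit iteration. *)

theory Submission
  imports Defs
begin

section \<open>Elementary facts on unital C*-algebras\<close>

lemma adj_one [simp]: "adj 1 = (1::'a::unital_cstar_algebra)"
  by (metis adj_adj adj_mult mult_1_right)

lemma adj_zero [simp]: "adj 0 = (0::'a::unital_cstar_algebra)"
  using adj_add[of 0 "0::'a"] by simp

lemma adj_minus: "adj (- x) = - adj (x::'a::unital_cstar_algebra)"
  using adj_add[of x "-x"] by (simp add: eq_neg_iff_add_eq_0 add.commute)

lemma adj_diff: "adj (x - y) = adj x - adj (y::'a::unital_cstar_algebra)"
  using adj_add[of x "-y"] by (simp add: adj_minus)

lemma adj_scaleR: "adj (r *\<^sub>R x) = r *\<^sub>R adj (x::'a::unital_cstar_algebra)"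
  by (simp add: scaleR_scaleC adj_scaleC)

lemma adj_sum: "adj (\<Sum>i\<in>I. f i) = (\<Sum>i\<in>I. adj (f i :: 'a::unital_cstar_algebra))"
  by (induction I rule: infinite_finite_induct) (simp_all add: adj_add)

lemma scaleC_minus_right: "c *\<^sub>C (- x) = - (c *\<^sub>C (x::'a::unital_cstar_algebra))"
  by (metis mult_minus_right mult_scaleC_right mult_1_left mult_scaleC_left)

lemma scaleC_diff_right: "c *\<^sub>C (x - y) = c *\<^sub>C x - c *\<^sub>C (y::'a::unital_cstar_algebra)"
  using scaleC_add_right[of c x "- y"] by (simp add: scaleC_minus_right)

lemma scaleC_sum_right:
  "c *\<^sub>C (\<Sum>i\<in>I. f i) = (\<Sum>i\<in>I. c *\<^sub>C (f i :: 'a::unital_cstar_algebra))"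
  by (metis (no_types, lifting) mult_1_left mult_scaleC_left sum.cong sum_distrib_left)

lemma scaleC_minus_left: "(- c) *\<^sub>C x = - (c *\<^sub>C (x::'a::unital_cstar_algebra))"
  by (metis scaleC_scaleC scaleC_minus_right mult_minus1_right scaleR_minus1_left scaleR_scaleC
      of_real_1 of_real_minus)

text \<open>The C*-identity makes the norm of 1 idempotent, hence 0 or 1; the value 0 occurs in the
  zero algebra.\<close>

lemma norm_one_le: "norm (1::'a::unital_cstar_algebra) \<le> 1"
proof -
  have "norm (1::'a) = (norm (1::'a))\<^sup>2"
    using norm_adj_mult[of "1::'a"] by simp
  then show ?thesis
    by (cases "norm (1::'a) = 0") (auto simp: power2_eq_square)
qed

lemma norm_scaleR_one_le: "0 \<le> t \<Longrightarrow> norm (t *\<^sub>R (1::'a::unital_cstar_algebra)) \<le> t"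
  using norm_one_le mult_left_mono[of "norm (1::'a)" 1 t] by simp

lemma norm_adj: "norm (adj x) = norm (x::'a::unital_cstar_algebra)"
proof -
  have le: "norm z \<le> norm (adj z)" for z :: 'a
  proof (cases "z = 0")
    case False
    have "norm z * norm z \<le> norm (adj z) * norm z"
      using norm_mult_ineq[of "adj z" z] by (simp add: norm_adj_mult power2_eq_square)
    then show ?thesis using False by simp
  qed simp
  from le[of x] le[of "adj x"] show ?thesis by (simp add: adj_adj)
qed

lemma bounded_linear_adj: "bounded_linear (adj :: 'a::unital_cstar_algebra \<Rightarrow> 'a)"
  by (rule bounded_linear_intro[where K = 1]) (simp_all add: adj_add adj_scaleR norm_adj)

lemma norm_selfadjoint_square:
  "adj x = x \<Longrightarrow> norm (x * x) = (norm (x::'a::unital_cstar_algebra))\<^sup>2"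
  by (metis norm_adj_mult)

text \<open>The normal element \<open>z = x + iy\<close> satisfies \<open>z\<^sup>* z = x\<^sup>2 + y\<^sup>2\<close>, and \<open>x\<close> is its real part.\<close>

lemma norm_square_le_norm_sum_squares:
  fixes x y :: "'a::unital_cstar_algebra"
  assumes "adj x = x" "adj y = y" "x * y = y * x"
  shows "norm (x * x) \<le> norm (x * x + y * y)"
proof -
  define z where "z = x + \<i> *\<^sub>C y"
  have az: "adj z = x - \<i> *\<^sub>C y"
    by (simp add: z_def adj_add adj_scaleC assms scaleC_minus_left)
  have "adj z * z = x * x + y * y"
    unfolding az by (simp add: z_def algebra_simps mult_scaleC_left mult_scaleC_right
        scaleC_scaleC scaleC_diff_right assms(3) scaleC_minus_left scaleC_one)
  then have n: "(norm z)\<^sup>2 = norm (x * x + y * y)"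
    using norm_adj_mult[of z] by simp
  have "2 *\<^sub>R x = z + adj z" unfolding az by (simp add: z_def scaleR_2)
  then have "2 * norm x \<le> norm z + norm (adj z)"
    by (metis norm_triangle_ineq norm_scaleR abs_numeral)
  then have "norm x \<le> norm z" by (simp add: norm_adj)
  then have "(norm x)\<^sup>2 \<le> (norm z)\<^sup>2" by (simp add: power_mono)
  then show ?thesis using n norm_selfadjoint_square[OF assms(1)] by simp
qed

section \<open>Square roots\<close>

text \<open>The root of \<open>1 - k\<close> is \<open>1 - y\<close>, where \<open>y\<close> solves \<open>y = (k + y\<^sup>2) / 2\<close>. The iteration from 0 is
  dominated by the same real iteration with \<open>k = 1\<close>, which increases to 1.\<close>

lemma square_root_one_minus:
  fixes k :: "'a::unital_cstar_algebra"
  assumes k: "adj k = k" "norm k \<le> 1"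
  obtains y where "adj y = y" "norm y \<le> 1" "(1 - y) * (1 - y) = 1 - k"
    "\<And>z. z * k = k * z \<Longrightarrow> z * y = y * z"
proof -
  define Y where "Y = rec_nat (0::'a) (\<lambda>_ y. (1/2) *\<^sub>R (k + y * y))"
  define t where "t = rec_nat (0::real) (\<lambda>_ y. (1/2) * (1 + y * y))"
  have Y0: "Y 0 = 0" and YS: "Y (Suc n) = (1/2) *\<^sub>R (k + Y n * Y n)" for n
    by (simp_all add: Y_def)
  have t0: "t 0 = 0" and tS: "t (Suc n) = (1/2) * (1 + t n * t n)" for n
    by (simp_all add: t_def)
  have sa: "adj (Y n) = Y n" for n
    by (induction n) (simp_all add: Y0 YS adj_scaleR adj_add adj_mult k)
  have comm: "z * Y n = Y n * z" if "z * k = k * z" for z n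
  proof (induction n)
    case (Suc n)
    have "z * (Y n * Y n) = Y n * Y n * z" by (metis Suc mult.assoc)
    then show ?case using that by (simp add: YS algebra_simps)
  qed (simp add: Y0)
  \<comment> \<open>The case \<open>z = k\<close> of \<open>comm\<close> shows that each iterate
    commutes with \<open>k\<close>, which is what \<open>comm\<close> asks of
    \<open>z = Y m\<close>.\<close>
  have commY: "Y m * Y n = Y n * Y m" for m n
    using comm[of "Y m" n] comm[of k m] by metis
  have t01: "0 \<le> t n \<and> t n \<le> 1" for n
  proof (induction n)
    case (Suc n)
    then have "t n * t n \<le> 1" by (simp add: mult_le_one)
    then show ?case by (simp add: tS)
  qed (simp add: t0)
  have tinc: "t n \<le> t (Suc n)" for n
  proof -
    have "t (Suc n) - t n = (1 - t n)\<^sup>2 / 2"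
      by (simp add: tS power2_eq_square field_simps)
    then show ?thesis by (smt (verit) zero_le_power2 divide_nonneg_pos)
  qed
  have Yt: "norm (Y n) \<le> t n" for n
  proof (induction n)
    case (Suc n)
    have "norm (Y n * Y n) \<le> t n * t n"
      using norm_mult_ineq[of "Y n" "Y n"] mult_mono[OF Suc Suc] t01[of n] by simp
    then have "norm (k + Y n * Y n) \<le> 1 + t n * t n"
      using norm_triangle_ineq[of k "Y n * Y n"] k(2) by linarith
    then show ?case by (simp add: YS tS)
  qed (simp add: Y0 t0)
  have dY: "norm (Y (Suc n) - Y n) \<le> t (Suc n) - t n" for n
  proof (induction n)
    case 0
    show ?case using k(2) by (simp add: Y0 YS t0 tS)
  next
    case (Suc n)
    have "Y (Suc (Suc n)) - Y (Suc n) = (1/2) *\<^sub>R (Y (Suc n) * Y (Suc n) - Y n * Y n)"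
      unfolding YS[of "Suc n"] by (subst (3) YS) (simp add: algebra_simps)
    \<comment> \<open>As the iterates commute, the difference of squares factors, just as it does
      for \<open>t\<close>.\<close>
    also have "Y (Suc n) * Y (Suc n) - Y n * Y n = (Y (Suc n) - Y n) * (Y (Suc n) + Y n)"
      using commY[of n "Suc n"] by (simp add: algebra_simps)
    finally have *: "norm (Y (Suc (Suc n)) - Y (Suc n))
        \<le> (1/2) * (norm (Y (Suc n) - Y n) * norm (Y (Suc n) + Y n))"
      using norm_mult_ineq by simp
    have "norm (Y (Suc n) + Y n) \<le> t (Suc n) + t n"
      by (meson Yt add_mono norm_triangle_ineq order_trans)
    then have "norm (Y (Suc n) - Y n) * norm (Y (Suc n) + Y n)
        \<le> (t (Suc n) - t n) * (t (Suc n) + t n)"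
      using Suc tinc[of n] by (intro mult_mono) auto
    also have "\<dots> = t (Suc n) * t (Suc n) - t n * t n" by (simp add: algebra_simps)
    also have "\<dots> = 2 * (t (Suc (Suc n)) - t (Suc n))"
      unfolding tS[of "Suc n"] by (subst (5) tS) (simp add: algebra_simps)
    finally show ?case using * by simp
  qed
  have "incseq t" using tinc by (simp add: incseq_SucI)
  then have "convergent t"
    using t01 by (intro Bseq_monoseq_convergent incseq_imp_monoseq BseqI'[where K = 1]) auto
  then obtain T where "t \<longlonglongrightarrow> T" by (auto simp: convergent_def)
  then have "summable (\<lambda>n. t (Suc n) - t n)" by (rule telescope_summable)
  then have "summable (\<lambda>n. Y (Suc n) - Y n)"
    by (rule summable_comparison_test') (use dY in auto)
  then obtain y where "(\<lambda>n. \<Sum>i<n. Y (Suc i) - Y i) \<longlonglongrightarrow> y"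
    using summable_LIMSEQ by blast
  then have lim: "Y \<longlonglongrightarrow> y" by (simp add: sum_lessThan_telescope Y0)
  have "(\<lambda>n. adj (Y n)) \<longlonglongrightarrow> adj y"
    by (rule bounded_linear.tendsto[OF bounded_linear_adj lim])
  then have 1: "adj y = y" using lim LIMSEQ_unique by (simp add: sa)
  have 2: "norm y \<le> 1"
    using tendsto_norm[OF lim] by (rule LIMSEQ_le_const2) (use Yt t01 order_trans in blast)
  have "(\<lambda>n. Y (Suc n)) \<longlonglongrightarrow> (1/2) *\<^sub>R (k + y * y)"
    unfolding YS by (intro tendsto_intros lim)
  then have "y = (1/2) *\<^sub>R (k + y * y)"
    using LIMSEQ_Suc[OF lim] LIMSEQ_unique by blast
  then have "y + y = k + y * y"
    by (metis scaleR_2 scaleR_scaleR mult.commute nonzero_eq_divide_eq zero_neq_numeral scaleR_one)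
  then have 3: "(1 - y) * (1 - y) = 1 - k" by (simp add: algebra_simps)
  have 4: "z * y = y * z" if "z * k = k * z" for z
  proof -
    have "(\<lambda>n. z * Y n) \<longlonglongrightarrow> z * y" "(\<lambda>n. Y n * z) \<longlonglongrightarrow> y * z"
      by (intro tendsto_intros lim)+
    then show ?thesis using LIMSEQ_unique by (simp add: comm[OF that])
  qed
  from that[OF 1 2 3 4] show thesis .
qed

text \<open>Writing \<open>u = t (1 - k)\<close> turns the hypothesis into
  \<open>norm k \<le> 1\<close>. The last conclusion is the same criterion for the root, so that the
  root is itself positive.\<close>

lemma square_root:
  fixes u :: "'a::unital_cstar_algebra"
  assumes u: "adj u = u" "norm (t *\<^sub>R 1 - u) \<le> t"
  obtains v where "adj v = v" "v * v = u" "\<And>z. z * u = u * z \<Longrightarrow> z * v = v * z"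
    "norm (sqrt t *\<^sub>R 1 - v) \<le> sqrt t"
proof (cases "t = 0")
  case True
  then show thesis using u that[of 0] by simp
next
  case False
  then have t: "0 < t" using u(2) norm_ge_zero[of "t *\<^sub>R 1 - u"] by linarith
  define k where "k = 1 - (1/t) *\<^sub>R u"
  have "k = (1/t) *\<^sub>R (t *\<^sub>R 1 - u)" using t by (simp add: k_def algebra_simps)
  then have "norm k = norm (t *\<^sub>R 1 - u) / t" using t by simp
  then have "norm k \<le> 1" using t u(2) by simp
  moreover have "adj k = k" by (simp add: k_def adj_diff adj_scaleR u)
  ultimately obtain y where y: "adj y = y" "norm y \<le> 1" "(1 - y) * (1 - y) = 1 - k"
    "\<And>z. z * k = k * z \<Longrightarrow> z * y = y * z" using square_root_one_minus[of k] by blast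
  show thesis
  proof (rule that[of "sqrt t *\<^sub>R (1 - y)"])
    show "adj (sqrt t *\<^sub>R (1 - y)) = sqrt t *\<^sub>R (1 - y)"
      by (simp add: adj_scaleR adj_diff y)
    show "sqrt t *\<^sub>R (1 - y) * (sqrt t *\<^sub>R (1 - y)) = u"
      using t by (simp add: y k_def)
    show "z * (sqrt t *\<^sub>R (1 - y)) = sqrt t *\<^sub>R (1 - y) * z" if "z * u = u * z" for z
      using y(4)[of z] that by (simp add: k_def algebra_simps)
    have "sqrt t *\<^sub>R 1 - sqrt t *\<^sub>R (1 - y) = sqrt t *\<^sub>R y" by (simp add: algebra_simps)
    then show "norm (sqrt t *\<^sub>R 1 - sqrt t *\<^sub>R (1 - y)) \<le> sqrt t"
      using t y(2) by simp
  qed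
qed

text \<open>\<open>t - v * v\<close> lies within \<open>t\<close> of \<open>t\<close>, so it is a
  square \<open>w * w\<close> with \<open>w\<close> commuting with \<open>v\<close>. Then
  \<open>w * w + v * v = t\<close>, and the norm of a summand is at most that of the sum.\<close>

lemma norm_scalar_minus_square_le:
  fixes v :: "'a::unital_cstar_algebra"
  assumes v: "adj v = v" "norm (v * v) \<le> t"
  shows "norm (t *\<^sub>R 1 - v * v) \<le> t"
proof -
  have t: "0 \<le> t" using v(2) norm_ge_zero order_trans by blast
  have "adj (t *\<^sub>R 1 - v * v) = t *\<^sub>R 1 - v * v"
    by (simp add: adj_diff adj_scaleR adj_mult v(1))
  moreover have "norm (t *\<^sub>R 1 - (t *\<^sub>R 1 - v * v)) \<le> t" using v(2) by simp
  ultimately obtain w where w: "adj w = w" "w * w = t *\<^sub>R 1 - v * v"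
    "\<And>z. z * (t *\<^sub>R 1 - v * v) = (t *\<^sub>R 1 - v * v) * z \<Longrightarrow> z * w = w * z"
    by (rule square_root) (rule that)
  have "w * v = v * w" using w(3)[of v] by (simp add: algebra_simps)
  from norm_square_le_norm_sum_squares[OF w(1) v(1) this] show ?thesis
    using norm_scaleR_one_le[OF t, where 'a = 'a] by (simp add: w(2))
qed

section \<open>Invertible elements and spectra\<close>

definition invertible_elem :: "'a::monoid_mult \<Rightarrow> bool" where
  "invertible_elem a \<longleftrightarrow> (\<exists>b. b * a = 1 \<and> a * b = 1)"

lemma invertible_elemI: "l * a = 1 \<Longrightarrow> a * r = 1 \<Longrightarrow> invertible_elem a"
  unfolding invertible_elem_def by (metis mult.assoc mult_1_left mult_1_right)

lemma invertible_elem_factor: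
  assumes "invertible_elem (a * b)" "a * b = b * a"
  shows "invertible_elem a"
proof -
  from assms(1) obtain c where "c * (a * b) = 1" "a * b * c = 1"
    by (auto simp: invertible_elem_def)
  then have "c * b * a = 1" "a * (b * c) = 1" using assms(2) by (metis mult.assoc)+
  then show ?thesis by (rule invertible_elemI)
qed

lemma invertible_elem_scaleR:
  fixes a :: "'a::unital_cstar_algebra"
  assumes "invertible_elem a" "r \<noteq> 0"
  shows "invertible_elem (r *\<^sub>R a)"
proof -
  from assms(1) obtain b where "b * a = 1" "a * b = 1" by (auto simp: invertible_elem_def)
  then show ?thesis using assms(2)
    by (intro invertible_elemI[of "(1/r) *\<^sub>R b" _ "(1/r) *\<^sub>R b"]) auto
qed

lemma mem_spectrum_iff: "c \<in> spectrum a \<longleftrightarrow> \<not> invertible_elem (c *\<^sub>C 1 - a)"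
  by (simp add: spectrum_def invertible_elem_def)

text \<open>In place of the Neumann series, the contraction sending \<open>x\<close> to
  \<open>1 + (1 - m) * x\<close> and its mirror image have fixed points; these are a right and a
  left inverse of \<open>m\<close>.\<close>

lemma invertible_elem_near_one:
  fixes m :: "'a::unital_cstar_algebra"
  assumes "norm (1 - m) < 1"
  shows "invertible_elem m"
proof -
  have "\<exists>!x. 1 + (1 - m) * x = x"
  proof (rule banach_fix_type[OF _ assms])
    show "\<forall>x y. dist (1 + (1 - m) * x) (1 + (1 - m) * y) \<le> norm (1 - m) * dist x y"
      by (metis add_diff_cancel_left dist_norm norm_mult_ineq right_diff_distrib)
  qed simp
  then obtain r where "1 + (1 - m) * r = r" by blast
  then have "m * r = 1" by (simp add: algebra_simps)
  moreover have "\<exists>!x. 1 + x * (1 - m) = x"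
  proof (rule banach_fix_type[OF _ assms])
    show "\<forall>x y. dist (1 + x * (1 - m)) (1 + y * (1 - m)) \<le> norm (1 - m) * dist x y"
      by (metis add_diff_cancel_left dist_norm norm_mult_ineq left_diff_distrib mult.commute)
  qed simp
  then obtain l where "1 + l * (1 - m) = l" by blast
  then have "l * m = 1" by (simp add: algebra_simps)
  ultimately show ?thesis by (rule invertible_elemI[rotated])
qed

text \<open>Scaled by \<open>1 / (N + c)\<close>, the element is within
  \<open>N / (N + c) < 1\<close> of 1, because \<open>N - v * v\<close> has norm at most
  \<open>N\<close>.\<close>

lemma invertible_square_plus_scalar:
  fixes v :: "'a::unital_cstar_algebra"
  assumes v: "adj v = v" and c: "0 < c"
  shows "invertible_elem (v * v + c *\<^sub>R 1)"
proof -
  define N where "N = norm (v * v)"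
  have N: "0 \<le> N" by (simp add: N_def)
  define m where "m = (1 / (N + c)) *\<^sub>R (v * v + c *\<^sub>R 1)"
  have "1 - m = (1 / (N + c)) *\<^sub>R (N *\<^sub>R 1 - v * v)"
  proof -
    have "(1::'a) = (1 / (N + c)) *\<^sub>R ((N + c) *\<^sub>R 1)" using N c by simp
    then have "1 - m = (1 / (N + c)) *\<^sub>R ((N + c) *\<^sub>R 1 - (v * v + c *\<^sub>R 1))"
      unfolding m_def scaleR_diff_right by simp
    then show ?thesis by (simp add: algebra_simps)
  qed
  moreover have "norm (N *\<^sub>R 1 - v * v) \<le> N"
    by (rule norm_scalar_minus_square_le[OF v]) (simp add: N_def)
  ultimately have "norm (1 - m) \<le> N / (N + c)" using N c by (simp add: divide_right_mono)
  also have "\<dots> < 1" using N c by simp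
  finally have "invertible_elem ((N + c) *\<^sub>R m)"
    using N c by (intro invertible_elem_scaleR invertible_elem_near_one) auto
  then show ?thesis using N c by (simp add: m_def)
qed

text \<open>Write \<open>c - a = j - h\<close> with \<open>j = \<i> Im c\<close> and
  \<open>h = a - Re c\<close>. If \<open>Im c \<noteq> 0\<close>, then
  \<open>(j - h) * (- j - h) = h * h + (Im c)^2\<close> is invertible, and so is its factor
  \<open>j - h\<close>.\<close>

lemma spectrum_selfadjoint_real:
  fixes a :: "'a::unital_cstar_algebra"
  assumes a: "adj a = a" and c: "c \<in> spectrum a"
  shows "Im c = 0"
proof (rule ccontr)
  assume "Im c \<noteq> 0"
  define h where "h = a - Re c *\<^sub>R 1"
  have h: "adj h = h" by (simp add: h_def adj_diff adj_scaleR a)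
  have cc: "c *\<^sub>C (1::'a) = Re c *\<^sub>R 1 + (\<i> * Im c) *\<^sub>C 1"
    by (metis complex_eq scaleC_add_left scaleR_scaleC)
  define j :: 'a where "j = (\<i> * Im c) *\<^sub>C 1"
  have jj: "j * j = - ((Im c)\<^sup>2 *\<^sub>R 1)"
    unfolding j_def scaleR_scaleC
    by (simp add: mult_scaleC_left scaleC_scaleC power2_eq_square flip: scaleC_minus_left)
       (simp add: algebra_simps)
  have jh: "j * h = h * j" by (simp add: j_def mult_scaleC_left mult_scaleC_right)
  have "(j - h) * (- j - h) = h * h + (Im c)\<^sup>2 *\<^sub>R 1"
    using jh by (simp add: algebra_simps jj)
  moreover have "(j - h) * (- j - h) = (- j - h) * (j - h)"
    using jh by (simp add: algebra_simps)
  moreover have "invertible_elem (h * h + (Im c)\<^sup>2 *\<^sub>R 1)"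
    by (rule invertible_square_plus_scalar[OF h]) (use \<open>Im c \<noteq> 0\<close> in simp)
  ultimately have "invertible_elem (j - h)"
    by (metis invertible_elem_factor)
  moreover have "j - h = c *\<^sub>C 1 - a" unfolding cc j_def h_def by (simp add: algebra_simps)
  ultimately show False using c by (simp add: mem_spectrum_iff)
qed

text \<open>Jacobson's lemma: \<open>1 + y (c - x y)\<^sup>-\<^sup>1 x\<close> inverts \<open>c - y x\<close> up to the factor \<open>c\<close>.\<close>

lemma spectrum_mult_commute:
  fixes x y :: "'a::unital_cstar_algebra"
  assumes c: "c \<in> spectrum (y * x)" "c \<noteq> 0"
  shows "c \<in> spectrum (x * y)"
proof (rule ccontr)
  assume "c \<notin> spectrum (x * y)"
  then obtain b where b: "b * (c *\<^sub>C 1 - x * y) = 1" "(c *\<^sub>C 1 - x * y) * b = 1"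
    by (auto simp: mem_spectrum_iff invertible_elem_def)
  have b1: "b * (x * y) = c *\<^sub>C b - 1" using b(1)
    by (simp add: algebra_simps mult_scaleC_right)
  have b2: "x * (y * b) = c *\<^sub>C b - 1" using b(2)
    by (simp add: algebra_simps mult_scaleC_left)
  define d where "d = inverse c *\<^sub>C (1 + y * b * x)"
  have "y * b * x * (y * x) = y * (b * (x * y)) * x" by (simp add: mult.assoc)
  also have "\<dots> = c *\<^sub>C (y * b * x) - y * x"
    by (simp add: b1 algebra_simps mult_scaleC_right mult_scaleC_left)
  finally have l: "(1 + y * b * x) * (c *\<^sub>C 1 - y * x) = c *\<^sub>C 1"
    by (simp add: ring_distribs mult_scaleC_right scaleC_add_right)
  have "y * x * (y * b * x) = y * (x * (y * b)) * x" by (simp add: mult.assoc)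
  also have "\<dots> = c *\<^sub>C (y * b * x) - y * x"
    by (simp add: b2 algebra_simps mult_scaleC_right mult_scaleC_left)
  finally have r: "(c *\<^sub>C 1 - y * x) * (1 + y * b * x) = c *\<^sub>C 1"
    by (simp add: ring_distribs mult_scaleC_left scaleC_add_right)
  have "invertible_elem (c *\<^sub>C 1 - y * x)"
    by (rule invertible_elemI[of d _ d])
       (simp_all add: d_def mult_scaleC_left mult_scaleC_right l r scaleC_scaleC scaleC_one c(2))
  then show False using c(1) by (simp add: mem_spectrum_iff)
qed

section \<open>Positive elements\<close>

text \<open>For real \<open>c < 0\<close>, \<open>c - v * v\<close> is the negative of a square plus
  a positive scalar, hence invertible.\<close>

lemma cstar_positive_square:
  fixes v :: "'a::unital_cstar_algebra"
  assumes v: "adj v = v"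
  shows "cstar_positive (v * v)"
  unfolding cstar_positive_def
proof (intro conjI subsetI)
  show sa: "adj (v * v) = v * v" by (simp add: adj_mult v)
  fix c assume c: "c \<in> spectrum (v * v)"
  then have Im: "Im c = 0" by (rule spectrum_selfadjoint_real[OF sa])
  have "0 \<le> Re c"
  proof (rule ccontr)
    assume "\<not> 0 \<le> Re c"
    then have "invertible_elem ((- 1) *\<^sub>R (v * v + (- Re c) *\<^sub>R 1))"
      by (intro invertible_elem_scaleR invertible_square_plus_scalar v) auto
    moreover have "c *\<^sub>C (1::'a) = Re c *\<^sub>R 1"
      using Im by (simp add: scaleR_scaleC complex_is_Real_iff)
    ultimately show False using c by (simp add: mem_spectrum_iff)
  qed
  with Im show "c \<in> \<real>\<^sub>\<ge>\<^sub>0" by (simp add: complex_nonneg_Reals_iff)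
qed

text \<open>With \<open>b\<close> the self-adjoint inverse of \<open>v\<close> and
  \<open>1 - y\<close> a root of \<open>1 - e b^2\<close>, take \<open>w = v (1 - y)\<close> and use
  \<open>v^2 b^2 = 1\<close>.\<close>

lemma invertible_square_minus_scalar_is_square:
  fixes v :: "'a::unital_cstar_algebra"
  assumes v: "adj v = v" and inv: "invertible_elem (v * v)" and s: "0 < s"
  obtains e w where "0 < e" "e \<le> s" "adj w = w" "w * w = v * v - e *\<^sub>R 1"
proof -
  have "invertible_elem v" using inv by (rule invertible_elem_factor) simp
  then obtain b where b: "b * v = 1" "v * b = 1" by (auto simp: invertible_elem_def)
  have "adj b * v = 1" by (metis adj_mult adj_one b(2) v)
  then have ab: "adj b = b" by (metis b(2) mult.assoc mult_1_left mult_1_right)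
  \<comment> \<open>Small enough for \<open>norm (e b^2) \<le> 1\<close>; the added 1 keeps
    \<open>e\<close> positive even in the zero algebra, where \<open>b = 0\<close>.\<close>
  define e where "e = min s (1 / (1 + norm (b * b)))"
  have p: "0 < 1 + norm (b * b)" by (simp add: add_pos_nonneg)
  have e: "0 < e" "e \<le> s" using s p by (auto simp: e_def)
  have "e * norm (b * b) \<le> 1 / (1 + norm (b * b)) * (1 + norm (b * b))"
    by (rule mult_mono) (use p in \<open>auto simp: e_def\<close>)
  then have "norm (e *\<^sub>R (b * b)) \<le> 1" using e(1) p by simp
  moreover have "adj (e *\<^sub>R (b * b)) = e *\<^sub>R (b * b)" by (simp add: adj_scaleR adj_mult ab)
  ultimately obtain y where y: "adj y = y" "(1 - y) * (1 - y) = 1 - e *\<^sub>R (b * b)"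
    "\<And>z. z * (e *\<^sub>R (b * b)) = e *\<^sub>R (b * b) * z \<Longrightarrow> z * y = y * z"
    using square_root_one_minus[of "e *\<^sub>R (b * b)"] by blast
  have vbb: "v * (b * b) = b" "b * b * v = b" using b
    by (metis mult.assoc mult_1_left, metis mult.assoc mult_1_right)
  have vy: "v * y = y * v" by (rule y(3)) (simp add: vbb)
  have "v * (1 - y) = (1 - y) * v" using vy by (simp add: algebra_simps)
  then have "v * (1 - y) * (v * (1 - y)) = v * (v * ((1 - y) * (1 - y)))"
    by (metis mult.assoc)
  also have "\<dots> = v * v - e *\<^sub>R 1"
    unfolding y(2) using vbb b by (simp add: right_diff_distrib)
  finally have "v * (1 - y) * (v * (1 - y)) = v * v - e *\<^sub>R 1" .
  moreover have "adj (v * (1 - y)) = v * (1 - y)"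
    using vy by (simp add: adj_mult adj_diff y v algebra_simps)
  ultimately show thesis using that e by blast
qed

text \<open>For \<open>t \<ge> 0\<close>, \<open>a + t\<close> is a square iff \<open>\<parallel>\<parallel>a\<parallel> - a\<parallel> \<le> \<parallel>a\<parallel> + t\<close>. If \<open>s > 0\<close> were the least such \<open>t\<close>, then
  \<open>a + s\<close> would be an invertible square, and a slightly smaller \<open>t\<close> would also do.\<close>

lemma cstar_positive_norm:
  fixes a :: "'a::unital_cstar_algebra"
  assumes a: "cstar_positive a"
  shows "norm (norm a *\<^sub>R 1 - a) \<le> norm a"
proof (rule ccontr)
  have sa: "adj a = a" and spec: "spectrum a \<subseteq> \<real>\<^sub>\<ge>\<^sub>0" using a by (auto simp: cstar_positive_def)
  define s where "s = norm (norm a *\<^sub>R 1 - a) - norm a"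
  assume "\<not> norm (norm a *\<^sub>R 1 - a) \<le> norm a"
  then have s: "0 < s" by (simp add: s_def)
  have "(norm a + s) *\<^sub>R 1 - (a + s *\<^sub>R 1) = norm a *\<^sub>R 1 - a" by (simp add: algebra_simps)
  then have "norm ((norm a + s) *\<^sub>R 1 - (a + s *\<^sub>R 1)) \<le> norm a + s" by (simp only: s_def)
  moreover have "adj (a + s *\<^sub>R 1) = a + s *\<^sub>R 1" by (simp add: adj_add adj_scaleR sa)
  ultimately obtain v where v: "adj v = v" "v * v = a + s *\<^sub>R 1"
    using square_root[of "a + s *\<^sub>R 1"] by metis
  have "complex_of_real (- s) \<notin> spectrum a"
    using spec s by (auto simp: complex_nonneg_Reals_iff)
  then have "invertible_elem ((- s) *\<^sub>R 1 - a)"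
    unfolding mem_spectrum_iff scaleR_scaleC by simp
  then have "invertible_elem ((- 1) *\<^sub>R ((- s) *\<^sub>R 1 - a))"
    by (rule invertible_elem_scaleR) simp
  then have "invertible_elem (v * v)" by (simp add: v(2))
  then obtain e w where e: "0 < e" "e \<le> s" "adj w = w" "w * w = a + s *\<^sub>R 1 - e *\<^sub>R 1"
    using invertible_square_minus_scalar_is_square[OF v(1) _ s] v(2) by metis
  have ww: "w * w = a + (s - e) *\<^sub>R 1" by (simp add: e(4) algebra_simps)
  \<comment> \<open>The square \<open>w * w = a + (s - e)\<close> yields the norm bound with
    \<open>s - e\<close> in place of \<open>s\<close>, against the choice of
    \<open>s\<close>.\<close>
  have "norm (w * w) \<le> norm a + (s - e)"
    unfolding ww using norm_triangle_ineq[of a "(s - e) *\<^sub>R 1"]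
      norm_scaleR_one_le[of "s - e", where 'a = 'a] e(2) by linarith
  then have "norm ((norm a + (s - e)) *\<^sub>R 1 - w * w) \<le> norm a + (s - e)"
    by (rule norm_scalar_minus_square_le[OF e(3)])
  moreover have "(norm a + (s - e)) *\<^sub>R 1 - w * w = norm a *\<^sub>R 1 - a"
    by (simp add: ww algebra_simps)
  ultimately show False using e(1) by (simp add: s_def)
qed

lemma cstar_positive_square_root:
  fixes a :: "'a::unital_cstar_algebra"
  assumes "cstar_positive a"
  obtains v where "adj v = v" "v * v = a" "\<And>z. z * a = a * z \<Longrightarrow> z * v = v * z"
proof -
  have "adj a = a" using assms by (simp add: cstar_positive_def)
  from this cstar_positive_norm[OF assms] show thesis by (rule square_root) (rule that)
qed

text \<open>Converse of \<open>cstar_positive_norm\<close>: the bound supplies a self-adjoint square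
  root. In this form positivity passes to sums by the triangle inequality.\<close>

lemma cstar_positiveI_norm:
  fixes a :: "'a::unital_cstar_algebra"
  assumes "adj a = a" "norm (t *\<^sub>R 1 - a) \<le> t"
  shows "cstar_positive a"
proof -
  from assms obtain v where "adj v = v" "v * v = a" by (rule square_root) (rule that)
  then show ?thesis using cstar_positive_square[of v] by simp
qed

section \<open>The order defined by the positive cone\<close>

lemma cstar_positive_selfadjoint: "cstar_positive a \<Longrightarrow> adj a = a"
  by (simp add: cstar_positive_def)

lemma cstar_positive_zero: "cstar_positive (0::'a::unital_cstar_algebra)"
  using cstar_positive_square[of "0::'a"] by simp

lemma cstar_positive_add:
  fixes a b :: "'a::unital_cstar_algebra"
  assumes "cstar_positive a" "cstar_positive b"
  shows "cstar_positive (a + b)"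
proof (rule cstar_positiveI_norm[of _ "norm a + norm b"])
  show "adj (a + b) = a + b" using assms by (simp add: adj_add cstar_positive_selfadjoint)
  have "(norm a + norm b) *\<^sub>R 1 - (a + b) = (norm a *\<^sub>R 1 - a) + (norm b *\<^sub>R 1 - b)"
    by (simp add: algebra_simps)
  also have "norm \<dots> \<le> norm a + norm b"
    using assms[THEN cstar_positive_norm] by (intro norm_triangle_mono)
  finally show "norm ((norm a + norm b) *\<^sub>R 1 - (a + b)) \<le> norm a + norm b" .
qed

lemma cstar_positive_sum:
  "(\<And>i. i \<in> I \<Longrightarrow> cstar_positive (f i)) \<Longrightarrow> cstar_positive (\<Sum>i\<in>I. f i)"
  by (induction I rule: infinite_finite_induct) (auto simp: cstar_positive_zero cstar_positive_add)

lemma cstar_positive_scaleR: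
  fixes a :: "'a::unital_cstar_algebra"
  assumes "cstar_positive a" "0 \<le> r"
  shows "cstar_positive (r *\<^sub>R a)"
proof -
  from assms(1) obtain v where v: "adj v = v" "v * v = a"
    by (rule cstar_positive_square_root) (rule that)
  have "r *\<^sub>R a = (sqrt r *\<^sub>R v) * (sqrt r *\<^sub>R v)" using assms(2) v by simp
  then show ?thesis by (metis cstar_positive_square adj_scaleR v(1))
qed

text \<open>Roots \<open>v\<close> of \<open>a\<close> and \<open>w\<close> of \<open>- a\<close>
  commute and satisfy \<open>v * v + w * w = 0\<close>, so \<open>v * v\<close> has norm 0.\<close>

lemma cstar_positive_antisym:
  fixes a :: "'a::unital_cstar_algebra"
  assumes "cstar_positive a" "cstar_positive (- a)"
  shows "a = 0"
proof -
  from assms(1) obtain v where v: "adj v = v" "v * v = a"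
    by (rule cstar_positive_square_root) (rule that)
  from assms(2) obtain w where w: "adj w = w" "w * w = - a"
    "\<And>z. z * (- a) = - a * z \<Longrightarrow> z * w = w * z"
    by (rule cstar_positive_square_root) (rule that)
  have "v * w = w * v" by (rule w(3)) (simp flip: v(2) add: mult.assoc)
  from norm_square_le_norm_sum_squares[OF v(1) w(1) this] show ?thesis by (simp add: v w)
qed

lemma cstar_positive_norm_minus:
  fixes a :: "'a::unital_cstar_algebra"
  assumes "adj a = a"
  shows "cstar_positive (norm a *\<^sub>R 1 - a)"
  by (rule cstar_positiveI_norm[of _ "norm a"]) (simp_all add: assms adj_diff adj_scaleR)

text \<open>Since \<open>a\<close> lies below \<open>b\<close> and \<open>b\<close> below the scalar
  \<open>norm b\<close>, both \<open>a\<close> and \<open>norm b - a\<close> have roots. These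
  commute and their squares add up to \<open>norm b\<close>.\<close>

lemma cstar_positive_norm_mono:
  fixes a b :: "'a::unital_cstar_algebra"
  assumes a: "cstar_positive a" and ba: "cstar_positive (b - a)"
  shows "norm a \<le> norm b"
proof -
  have "adj (a + (b - a)) = a + (b - a)"
    using a ba by (metis adj_add cstar_positive_selfadjoint)
  then have "cstar_positive (norm b *\<^sub>R 1 - b)" by (intro cstar_positive_norm_minus) simp
  from cstar_positive_add[OF this ba] have "cstar_positive (norm b *\<^sub>R 1 - a)" by simp
  then obtain w where w: "adj w = w" "w * w = norm b *\<^sub>R 1 - a"
    "\<And>z. z * (norm b *\<^sub>R 1 - a) = (norm b *\<^sub>R 1 - a) * z \<Longrightarrow> z * w = w * z"
    by (rule cstar_positive_square_root) (rule that)
  from a obtain v where v: "adj v = v" "v * v = a"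
    by (rule cstar_positive_square_root) (rule that)
  have "v * a = a * v" by (simp flip: v(2) add: mult.assoc)
  then have "v * w = w * v" by (intro w(3)) (simp add: algebra_simps)
  from norm_square_le_norm_sum_squares[OF v(1) w(1) this]
  have "norm a \<le> norm (norm b *\<^sub>R (1::'a))" by (simp add: v w)
  also have "\<dots> \<le> norm b" by (rule norm_scaleR_one_le) simp
  finally show ?thesis .
qed

section \<open>Absolute values and the positivity of \<open>adj x * x\<close>\<close>

lemma cstar_positive_minus_of_equal_squares:
  fixes r a :: "'a::unital_cstar_algebra"
  assumes r: "cstar_positive r" and a: "adj a = a" and comm: "r * a = a * r"
    and sq: "r * r = a * a"
  shows "cstar_positive (r - a)"
  unfolding cstar_positive_def
proof (intro conjI subsetI)
  show sa: "adj (r - a) = r - a" using r by (simp add: adj_diff a cstar_positive_selfadjoint)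
  fix c assume c: "c \<in> spectrum (r - a)"
  then have Im: "Im c = 0" by (rule spectrum_selfadjoint_real[OF sa])
  have "0 \<le> Re c"
  proof (rule ccontr)
    assume neg: "\<not> 0 \<le> Re c"
    define s where "s = - Re c"
    have s: "0 < s" using neg by (simp add: s_def)
    obtain v where v: "adj v = v" "v * v = r"
      using r by (rule cstar_positive_square_root) (rule that)
    have "invertible_elem ((2 * s) *\<^sub>R (r + (s / 2) *\<^sub>R 1))"
      using invertible_square_plus_scalar[OF v(1), of "s / 2"] s
      by (intro invertible_elem_scaleR) (simp_all add: v(2))
    \<comment> \<open>Difference of squares: \<open>(r + s)^2 - a^2 = 2 s r + s^2\<close>, as
      \<open>r\<close> and \<open>a\<close> have equal squares.\<close>
    moreover have "(r + s *\<^sub>R 1 - a) * (r + s *\<^sub>R 1 + a) = (2 * s) *\<^sub>R (r + (s / 2) *\<^sub>R 1)"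
      by (simp add: algebra_simps comm sq flip: scaleR_2)
    moreover have "(r + s *\<^sub>R 1 - a) * (r + s *\<^sub>R 1 + a) = (r + s *\<^sub>R 1 + a) * (r + s *\<^sub>R 1 - a)"
      by (simp add: algebra_simps comm sq)
    ultimately have "invertible_elem (r + s *\<^sub>R 1 - a)"
      by (metis invertible_elem_factor)
    then have "invertible_elem ((- 1) *\<^sub>R (r + s *\<^sub>R 1 - a))"
      by (rule invertible_elem_scaleR) simp
    moreover have "c *\<^sub>C (1::'a) = - (s *\<^sub>R 1)"
      using Im unfolding s_def scaleR_minus_left
      by (simp add: scaleR_scaleC complex_is_Real_iff)
    then have "c *\<^sub>C 1 - (r - a) = (- 1) *\<^sub>R (r + s *\<^sub>R 1 - a)" by (simp add: algebra_simps)
    ultimately show False using c by (metis mem_spectrum_iff)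
  qed
  with Im show "c \<in> \<real>\<^sub>\<ge>\<^sub>0" by (simp add: complex_nonneg_Reals_iff)
qed

text \<open>Up to sign, \<open>h\<close> and \<open>k\<close> are twice the real and imaginary parts
  of \<open>y\<close>; in \<open>h * h + k * k\<close> the terms \<open>y * y\<close> and
  \<open>adj y * adj y\<close> cancel.\<close>

lemma cstar_positive_mult_adj_plus_adj_mult:
  fixes y :: "'a::unital_cstar_algebra"
  shows "cstar_positive (y * adj y + adj y * y)"
proof -
  define h where "h = y + adj y"
  define k where "k = \<i> *\<^sub>C (y - adj y)"
  have "adj h = h" "adj k = k"
    by (simp_all add: h_def k_def adj_add adj_adj add.commute adj_scaleC adj_diff
        scaleC_minus_left flip: scaleC_minus_right)
  then have "cstar_positive ((1/2) *\<^sub>R (h * h + k * k))"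
    by (intro cstar_positive_scaleR cstar_positive_add cstar_positive_square) auto
  moreover have "k * k = - ((y - adj y) * (y - adj y))"
    by (simp add: k_def mult_scaleC_left mult_scaleC_right scaleC_scaleC scaleC_minus_left
        scaleC_one)
  then have "h * h + k * k = 2 *\<^sub>R (y * adj y + adj y * y)"
    by (simp add: h_def algebra_simps scaleR_2)
  ultimately show ?thesis by simp
qed

text \<open>Adding \<open>- (adj y * y)\<close> to the previous positive sum leaves
  \<open>y * adj y\<close> positive. Both products have the same nonzero spectrum, so
  \<open>adj y * y\<close> is positive along with its negative.\<close>

lemma adj_mult_eq_zero_if_negative:
  fixes y :: "'a::unital_cstar_algebra"
  assumes "cstar_positive (- (adj y * y))"
  shows "adj y * y = 0"
proof (rule cstar_positive_antisym[OF _ assms])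
  have "cstar_positive (y * adj y)"
    using cstar_positive_add[OF cstar_positive_mult_adj_plus_adj_mult[of y] assms] by simp
  then have "spectrum (y * adj y) \<subseteq> \<real>\<^sub>\<ge>\<^sub>0" by (simp add: cstar_positive_def)
  then show "cstar_positive (adj y * y)"
    using spectrum_mult_commute[of _ "adj y" y]
    by (force simp: cstar_positive_def adj_mult adj_adj)
qed

text \<open>If \<open>q\<close> is (twice) the negative part of \<open>x\<^sup>* x\<close>, then \<open>(x q)\<^sup>* (x q) = - q\<^sup>3 / 2\<close>, which forces \<open>q = 0\<close>.\<close>

theorem cstar_positive_adj_mult:
  fixes x :: "'a::unital_cstar_algebra"
  shows "cstar_positive (adj x * x)"
proof -
  define a where "a = adj x * x"
  have sa: "adj a = a" by (simp add: a_def adj_mult adj_adj)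
  have "adj (a * a) = a * a" by (simp add: adj_mult sa)
  moreover have "norm (norm (a * a) *\<^sub>R 1 - a * a) \<le> norm (a * a)"
    by (rule norm_scalar_minus_square_le[OF sa]) simp
  \<comment> \<open>\<open>r\<close> is the absolute value of \<open>a\<close>; its norm bound makes
    it positive.\<close>
  ultimately obtain r where r: "adj r = r" "r * r = a * a"
    "\<And>z. z * (a * a) = a * a * z \<Longrightarrow> z * r = r * z"
    and "norm (sqrt (norm (a * a)) *\<^sub>R 1 - r) \<le> sqrt (norm (a * a))"
    by (rule square_root) (rule that)
  then have rpos: "cstar_positive r" by (intro cstar_positiveI_norm)
  have ra: "r * a = a * r" using r(3)[of a] by (simp add: mult.assoc)
  define q where "q = r - a"
  have "cstar_positive q"
    unfolding q_def by (rule cstar_positive_minus_of_equal_squares[OF rpos sa ra r(2)])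
  then obtain v where v: "adj v = v" "v * v = q"
    by (rule cstar_positive_square_root) (rule that)
  have q: "adj q = q" by (simp add: q_def adj_diff sa r)
  define y where "y = x * q"
  have yy: "adj y * y = q * a * q" by (simp add: y_def adj_mult q a_def mult.assoc)
  \<comment> \<open>\<open>q * (r + a) = r * r - a * a = 0\<close>, so
    \<open>q * q = - 2 q a\<close>.\<close>
  have "2 *\<^sub>R (q * a * q) = - (q * q * q)"
    unfolding q_def scaleR_2 by (simp add: algebra_simps ra r(2))
  then have yy': "q * q * q = - (2 *\<^sub>R (adj y * y))" by (simp add: yy)
  have "q * q * q = (v * q) * (v * q)" by (simp flip: v(2) add: mult.assoc)
  moreover have "adj (v * q) = v * q" by (simp flip: v(2) add: adj_mult v(1) mult.assoc)
  ultimately have "cstar_positive (q * q * q)" by (simp add: cstar_positive_square)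
  from cstar_positive_scaleR[OF this, of "1/2"] have "cstar_positive (- (adj y * y))"
    by (simp add: yy')
  then have "adj y * y = 0" by (rule adj_mult_eq_zero_if_negative)
  then have "q * q * q = 0" by (simp add: yy')
  \<comment> \<open>The fourth power lets the C*-identity act twice, first on \<open>q * q\<close>
    and then on \<open>q\<close>.\<close>
  then have "(q * q) * (q * q) = 0" by (simp add: mult.assoc[symmetric])
  then have "norm (q * q) = 0"
    using norm_selfadjoint_square[of "q * q"] by (simp add: adj_mult q)
  then have "q = 0" using norm_selfadjoint_square[OF q] by simp
  then show ?thesis using rpos by (simp add: q_def a_def)
qed

section \<open>Hilbert modules\<close>

context hilbert_module
begin

section \<open>Sesquilinearity and the module norm\<close>

abbreviation mnorm where "mnorm \<equiv> module_norm ip"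

lemma ip_zero_right [simp]: "ip x 0 = 0"
  using ip_add_right[of x 0 0] by simp

lemma ip_minus_right: "ip x (- y) = - ip x y"
  using ip_add_right[of x y "- y"] by (simp add: eq_neg_iff_add_eq_0 add.commute)

lemma ip_diff_right: "ip x (y - z) = ip x y - ip x z"
  using ip_add_right[of x y "- z"] by (simp add: ip_minus_right)

lemma ip_add_left: "ip (x + y) z = ip x z + ip y z"
  by (metis adj_ip ip_add_right adj_add)

lemma ip_zero_left [simp]: "ip 0 x = 0"
  using ip_add_left[of 0 0 x] by simp

lemma ip_minus_left: "ip (- x) y = - ip x y"
  by (metis adj_ip ip_minus_right adj_minus)

lemma ip_diff_left: "ip (x - y) z = ip x z - ip y z"
  using ip_add_left[of x "- y" z] by (simp add: ip_minus_left)

lemma ip_scale_left: "ip (scale c x) y = cnj c *\<^sub>C ip x y"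
  by (metis adj_ip ip_scale_right adj_scaleC)

lemma ip_act_left: "ip (act x a) y = adj a * ip x y"
  by (metis adj_ip ip_act_right adj_mult)

lemma ip_sum_left: "ip (\<Sum>s\<in>S. f s) y = (\<Sum>s\<in>S. ip (f s) y)"
  by (induction S rule: infinite_finite_induct) (simp_all add: ip_add_left)

lemma mnorm_square: "(mnorm x)\<^sup>2 = norm (ip x x)"
  by (simp add: module_norm_def)

lemma mnorm_nonneg [simp]: "0 \<le> mnorm x"
  by (simp add: module_norm_def)

lemma mnorm_zero [simp]: "mnorm 0 = 0"
  by (simp add: module_norm_def)

lemma mnorm_eq_zero_iff [simp]: "mnorm x = 0 \<longleftrightarrow> x = 0"
  using ip_definite by (auto simp: module_norm_def)

lemma mnorm_minus [simp]: "mnorm (- x) = mnorm x"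
  by (simp add: module_norm_def ip_minus_left ip_minus_right)

lemma mnorm_minus_commute: "mnorm (x - y) = mnorm (y - x)"
  by (metis mnorm_minus minus_diff_eq)

lemma mnorm_scale: "mnorm (scale c x) = cmod c * mnorm x"
  by (simp add: module_norm_def ip_scale_left ip_scale_right norm_scaleC real_sqrt_mult)

text \<open>Expand \<open>ip z z\<close> for \<open>z = x a - N y\<close>, where
  \<open>a = ip x y\<close>, and bound \<open>adj a * ip x x * a\<close> by
  \<open>N (adj a * a)\<close>. Positivity gives \<open>N (adj a * a) \<le> N^2 ip y y\<close> in
  the order of the algebra, which norms respect.\<close>

lemma Cauchy_Schwarz: "norm (ip x y) \<le> mnorm x * mnorm y"
proof (cases "x = 0")
  case False
  define N where "N = norm (ip x x)"
  have N: "0 < N" using False ip_definite by (auto simp: N_def)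
  define a where "a = ip x y"
  define z where "z = act x a - scale (complex_of_real N) y"
  have aa: "ip y x = adj a" by (simp add: a_def adj_ip)
  have zz: "ip z z = adj a * ip x x * a - N *\<^sub>R (adj a * a) - N *\<^sub>R (adj a * a)
      + (N * N) *\<^sub>R ip y y"
    by (simp add: z_def ip_diff_left ip_diff_right ip_act_left ip_act_right ip_scale_left
        ip_scale_right aa mult_scaleC_right mult_scaleC_left algebra_simps flip: a_def scaleR_scaleC)
  have "cstar_positive (N *\<^sub>R 1 - ip x x)"
    unfolding N_def by (intro cstar_positive_norm_minus adj_ip)
  then obtain w where w: "adj w = w" "w * w = N *\<^sub>R 1 - ip x x"
    by (rule cstar_positive_square_root) (rule that)
  have "adj (w * a) * (w * a) = adj a * (w * w) * a" by (simp add: adj_mult w(1) mult.assoc)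
  also have "\<dots> = N *\<^sub>R (adj a * a) - adj a * ip x x * a"
    unfolding w(2) by (simp add: algebra_simps)
  finally have *: "cstar_positive (N *\<^sub>R (adj a * a) - adj a * ip x x * a)"
    using cstar_positive_adj_mult[of "w * a"] by (simp only:)
  have "cstar_positive ((N * N) *\<^sub>R ip y y - N *\<^sub>R (adj a * a))"
    using cstar_positive_add[OF ip_positive[of z] *] by (simp add: zz algebra_simps)
  moreover have "cstar_positive (N *\<^sub>R (adj a * a))"
    using N by (intro cstar_positive_scaleR cstar_positive_adj_mult) simp
  ultimately have "norm (N *\<^sub>R (adj a * a)) \<le> norm ((N * N) *\<^sub>R ip y y)"
    by (intro cstar_positive_norm_mono)
  then have "(norm a)\<^sup>2 \<le> N * norm (ip y y)" using N by (simp add: norm_adj_mult)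
  then have "(norm a)\<^sup>2 \<le> (mnorm x * mnorm y)\<^sup>2"
    by (simp add: power_mult_distrib mnorm_square N_def)
  then show ?thesis unfolding a_def by (rule power2_le_imp_le) simp
qed simp

lemma mnorm_triangle: "mnorm (x + y) \<le> mnorm x + mnorm y"
proof (rule power2_le_imp_le)
  have "(mnorm (x + y))\<^sup>2 = norm (ip x x + ip x y + (ip y x + ip y y))"
    by (simp add: mnorm_square ip_add_left ip_add_right algebra_simps)
  also have "\<dots> \<le> norm (ip x x) + norm (ip x y) + (norm (ip y x) + norm (ip y y))"
    by (meson add_mono norm_triangle_ineq order_trans)
  also have "\<dots> \<le> (mnorm x)\<^sup>2 + mnorm x * mnorm y + (mnorm y * mnorm x + (mnorm y)\<^sup>2)"
    using Cauchy_Schwarz[of x y] Cauchy_Schwarz[of y x] unfolding mnorm_square by linarith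
  also have "\<dots> = (mnorm x + mnorm y)\<^sup>2" by (simp add: power2_eq_square algebra_simps)
  finally show "(mnorm (x + y))\<^sup>2 \<le> (mnorm x + mnorm y)\<^sup>2" .
qed simp

lemma mnorm_triangle_diff: "mnorm (x - z) \<le> mnorm (x - y) + mnorm (y - z)"
  using mnorm_triangle[of "x - y" "y - z"] by simp

section \<open>A quantitative uniform boundedness argument\<close>

lemma geometric_step_limit:
  assumes step: "\<And>n. mnorm (z (Suc n) - z n) \<le> (1/3)^n"
  obtains l where "\<And>n. mnorm (l - z n) \<le> (3/2) * (1/3)^n"
proof -
  \<comment> \<open>\<open>(3/2) * (1/3)^n\<close> is the tail of the geometric series from index
    \<open>n\<close> on.\<close>
  have diff: "mnorm (z (n + k) - z n) \<le> (3/2) * (1/3)^n - (3/2) * (1/3)^(n + k)" for n k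
  proof (induction k)
    case (Suc k)
    have "mnorm (z (n + Suc k) - z n) \<le> mnorm (z (Suc (n + k)) - z (n + k)) + mnorm (z (n + k) - z n)"
      using mnorm_triangle_diff by simp
    also have "\<dots> \<le> (1/3)^(n + k) + ((3/2) * (1/3)^n - (3/2) * (1/3)^(n + k))"
      using step Suc by (intro add_mono)
    also have "\<dots> = (3/2) * (1/3)^n - (3/2) * (1/3)^(n + Suc k)" by simp
    finally show ?case .
  qed simp
  have le: "mnorm (z m - z n) \<le> (3/2) * (1/3)^n" if "n \<le> m" for m n
  proof -
    have "0 \<le> (3/2) * (1/3::real)^m" by simp
    then show ?thesis using diff[of n "m - n"] that unfolding le_add_diff_inverse[OF that] by linarith
  qed
  have "module_norm_Cauchy ip z"
    unfolding module_norm_Cauchy_def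
  proof (intro allI impI)
    fix e :: real assume "0 < e"
    \<comment> \<open>Points past \<open>N\<close> are each within \<open>(3/2) * (1/3)^N\<close> of
      \<open>z N\<close>, in total \<open>3 * (1/3)^N\<close>.\<close>
    then obtain N where N: "(1/3::real)^N < e / 3"
      using real_arch_pow_inv[of "e / 3" "1/3"] by auto
    have "mnorm (z m - z n) < e" if "N \<le> m" "N \<le> n" for m n
      using mnorm_triangle_diff[of "z m" "z n" "z N"] le[OF that(1)] le[OF that(2)] N
        mnorm_minus_commute[of "z N" "z n"] by linarith
    then show "\<exists>N. \<forall>m\<ge>N. \<forall>n\<ge>N. mnorm (z m - z n) < e" by blast
  qed
  then obtain l where l: "(\<lambda>n. mnorm (z n - l)) \<longlonglongrightarrow> 0"
    using complete by (auto simp: module_norm_convergent_def)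
  have "mnorm (l - z n) \<le> (3/2) * (1/3)^n" for n
  proof (rule LIMSEQ_le_const)
    show "(\<lambda>m. mnorm (z m - l) + (3/2) * (1/3)^n) \<longlonglongrightarrow> (3/2) * (1/3)^n"
      using tendsto_add[OF l tendsto_const] by simp
    have "mnorm (l - z n) \<le> mnorm (z m - l) + (3/2) * (1/3)^n" if "n \<le> m" for m
      using mnorm_triangle_diff[of l "z n" "z m"] le[OF that] mnorm_minus_commute[of l "z m"]
      by linarith
    then show "\<exists>N. \<forall>m\<ge>N. mnorm (l - z n) \<le> mnorm (z m - l) + (3/2) * (1/3)^n"
      by blast
  qed
  then show thesis by (rule that)
qed

text \<open>The gliding hump of Sokal's proof of the uniform boundedness principle: one of the two points
  \<open>z \<plusminus> 3\<^sup>-\<^sup>n u\<^sub>n\<close> is far from the kernel of \<open>\<langle>\<cdot>, u\<^sub>n\<rangle>\<close>, and the later steps are too short to undo this.\<close>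

lemma gliding_hump:
  assumes u: "\<And>n. mnorm (u n) = 1"
  obtains z where "\<And>n. (1/2) * (1/3)^n \<le> norm (ip z (u n))"
proof -
  define xi where "xi n = scale (complex_of_real ((1/3)^n)) (u n)" for n
  define z where "z = rec_nat 0 (\<lambda>n y. if (1/3)^n \<le> norm (ip (y + xi n) (u n))
    then y + xi n else y - xi n)"
  have zS: "z (Suc n) = (if (1/3)^n \<le> norm (ip (z n + xi n) (u n)) then z n + xi n else z n - xi n)" for n
    by (simp add: z_def)
  have nxi: "mnorm (xi n) = (1/3)^n" for n
    by (simp add: xi_def mnorm_scale u norm_power)
  have step: "mnorm (z (Suc n) - z n) \<le> (1/3)^n" for n
    by (simp add: zS nxi)
  have big: "(1/3)^n \<le> norm (ip (z (Suc n)) (u n))" for n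
  proof (cases "(1/3)^n \<le> norm (ip (z n + xi n) (u n))")
    case False
    have "norm (ip (xi n) (u n)) = (1/3)^n"
      using mnorm_square[of "u n"] by (simp add: xi_def ip_scale_left norm_scaleC u norm_power)
    \<comment> \<open>The two values differ by an element of norm \<open>2 * (1/3)^n\<close>, so the
      minus sign succeeds when the plus sign fails.\<close>
    moreover have "2 *\<^sub>R ip (xi n) (u n) = ip (z n + xi n) (u n) - ip (z n - xi n) (u n)"
      by (simp add: ip_add_left ip_diff_left scaleR_2)
    then have "2 * norm (ip (xi n) (u n))
        \<le> norm (ip (z n + xi n) (u n)) + norm (ip (z n - xi n) (u n))"
      by (metis norm_triangle_ineq4 norm_scaleR abs_numeral)
    ultimately show ?thesis using False by (simp add: zS)
  qed (simp add: zS)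
  obtain l where l: "\<And>n. mnorm (l - z n) \<le> (3/2) * (1/3)^n"
    using geometric_step_limit[OF step] by blast
  have "(1/2) * (1/3)^n \<le> norm (ip l (u n))" for n
  proof -
    \<comment> \<open>All later steps move the point by at most \<open>(3/2) * (1/3)^(n+1)\<close>,
      half of the size secured in step \<open>n\<close>.\<close>
    have "norm (ip (l - z (Suc n)) (u n)) \<le> (1/2) * (1/3)^n"
      using Cauchy_Schwarz[of "l - z (Suc n)" "u n"] l[of "Suc n"] by (simp add: u)
    moreover have "norm (ip (z (Suc n)) (u n))
        \<le> norm (ip l (u n)) + norm (ip (l - z (Suc n)) (u n))"
      by (metis ip_diff_left norm_minus_commute norm_triangle_sub)
    ultimately show ?thesis using big[of n] by linarith
  qed
  then show thesis by (rule that)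
qed

section \<open>Norming generators and the Schur property\<close>

lemma generators_norming:
  assumes S: "finite S" and gen: "\<And>x. \<exists>a. x = (\<Sum>s\<in>S. act s (a s))"
  obtains C where "0 < C" "\<And>x. mnorm x \<le> C * (\<Sum>s\<in>S. norm (ip s x))"
proof (rule ccontr)
  define g where "g x = (\<Sum>s\<in>S. norm (ip s x))" for x
  assume "\<not> thesis"
  then have "\<exists>x. 4^n * g x < mnorm x" for n :: nat
    using that[of "4^n"] unfolding g_def by (meson not_le zero_less_numeral zero_less_power)
  then obtain x where x: "\<And>n::nat. 4^n * g (x n) < mnorm (x n)" by metis
  have g0: "0 \<le> g y" for y by (simp add: g_def sum_nonneg)
  have pos: "0 < mnorm (x n)" for n
    by (rule le_less_trans[OF _ x[of n]]) (simp add: g0)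
  define u where "u n = scale (complex_of_real (1 / mnorm (x n))) (x n)" for n
  have "mnorm (u n) = 1" for n
    using pos[of n] by (simp add: u_def mnorm_scale norm_divide del: mnorm_eq_zero_iff)
  then obtain z where z: "\<And>n. (1/2) * (1/3)^n \<le> norm (ip z (u n))"
    using gliding_hump by blast
  have gu: "4^n * g (u n) \<le> 1" for n
  proof -
    have "g (u n) = g (x n) / mnorm (x n)"
      by (simp add: g_def u_def ip_scale_right norm_scaleC norm_divide sum_divide_distrib)
    then show ?thesis using x[of n] pos[of n] by (simp add: divide_le_eq)
  qed
  obtain a where a: "z = (\<Sum>s\<in>S. act s (a s))" using gen by blast
  \<comment> \<open>A common bound for the coefficients of \<open>z\<close>, independent of
    \<open>n\<close>.\<close>
  define K where "K = (\<Sum>s\<in>S. norm (a s))"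
  have zu: "norm (ip z (u n)) \<le> K * g (u n)" for n
  proof -
    have "norm (ip z (u n)) \<le> (\<Sum>s\<in>S. norm (a s) * norm (ip s (u n)))"
      unfolding a ip_sum_left ip_act_left
      by (intro order_trans[OF norm_sum] sum_mono) (metis norm_mult_ineq norm_adj)
    also have "\<dots> \<le> (\<Sum>s\<in>S. K * norm (ip s (u n)))"
      unfolding K_def using S by (intro sum_mono mult_right_mono member_le_sum) auto
    finally show ?thesis by (simp add: g_def sum_distrib_left)
  qed
  have "(4/3)^n \<le> 2 * K" for n :: nat
  proof -
    have K: "0 \<le> K" by (simp add: K_def sum_nonneg)
    have "(1/2) * (1/3)^n * 4^n \<le> K * g (u n) * 4^n"
      using z[of n] zu[of n] by (intro mult_right_mono) auto
    also have "\<dots> \<le> K * 1"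
      using mult_left_mono[OF gu[of n] K] by (simp add: mult.assoc mult.commute)
    finally show ?thesis by (simp add: power_divide)
  qed
  moreover obtain n where "2 * K < (4/3::real)^n" using real_arch_pow[of "4/3"] by auto
  ultimately show False by (meson not_le)
qed

lemma finitely_generated_imp_module_Schur:
  assumes "finitely_generated act"
  shows "module_Schur ip"
  unfolding module_Schur_def
\<comment> \<open>Completeness supplies the limit, so the Cauchy property remains.\<close>
proof (intro allI impI complete)
  fix X assume X: "tau_hat_convergent ip X"
  obtain S where S: "finite S" "\<And>x. \<exists>a. x = (\<Sum>s\<in>S. act s (a s))"
    using assms by (auto simp: finitely_generated_def)
  obtain C where C: "0 < C" "\<And>x. mnorm x \<le> C * (\<Sum>s\<in>S. norm (ip s x))"
    using generators_norming[OF S] by blast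
  show "module_norm_Cauchy ip X"
    unfolding module_norm_Cauchy_def
  proof (intro allI impI)
    fix e :: real assume e: "0 < e"
    \<comment> \<open>The added 1 keeps \<open>k\<close> positive when \<open>S\<close> is empty and
      makes the final estimate strict.\<close>
    define k where "k = C * (real (card S) + 1)"
    have k: "0 < k" using C(1) by (simp add: k_def add_nonneg_pos)
    define d where "d = e / k"
    have d: "0 < d" using e k by (simp add: d_def)
    have "\<forall>s. \<exists>N. \<forall>m\<ge>N. \<forall>n\<ge>N. norm (ip s (X m) - ip s (X n)) < d"
    proof
      fix s
      have "Cauchy (\<lambda>n. ip s (X n))"
        using X by (auto simp: tau_hat_convergent_def convergent_Cauchy)
      then show "\<exists>N. \<forall>m\<ge>N. \<forall>n\<ge>N. norm (ip s (X m) - ip s (X n)) < d"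
        using d by (rule CauchyD)
    qed
    then obtain N where N: "\<And>s m n. N s \<le> m \<Longrightarrow> N s \<le> n \<Longrightarrow> norm (ip s (X m) - ip s (X n)) < d"
      by metis
    define M where "M = (\<Sum>s\<in>S. N s)"
    have NM: "N s \<le> M" if "s \<in> S" for s
      unfolding M_def using S(1) that by (simp add: member_le_sum)
    have "mnorm (X m - X n) < e" if mn: "M \<le> m" "M \<le> n" for m n
    proof -
      have "(\<Sum>s\<in>S. norm (ip s (X m - X n))) \<le> of_nat (card S) * d"
        using N NM mn by (intro sum_bounded_above) (force simp: ip_diff_right intro: less_imp_le)
      then have "mnorm (X m - X n) \<le> C * (of_nat (card S) * d)"
        using C by (meson order_trans mult_left_mono less_imp_le)
      also have "\<dots> < k * d" using C(1) d by (simp add: k_def)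
      also have "\<dots> = e" using k by (simp add: d_def)
      finally show ?thesis .
    qed
    then show "\<exists>N. \<forall>m\<ge>N. \<forall>n\<ge>N. mnorm (X m - X n) < e" by blast
  qed
qed

end

section \<open>The standard modules\<close>

text \<open>The other summands of \<open>std_ip x x\<close> are positive, so one summand is below
  the whole in the order and hence in norm.\<close>

lemma norm_component_le_std:
  fixes x :: "'a::unital_cstar_algebra^'n::finite"
  shows "norm (x $ i) \<le> module_norm std_ip x"
proof -
  have eq: "std_ip x x = adj (x $ i) * x $ i + (\<Sum>j\<in>UNIV - {i}. adj (x $ j) * x $ j)"
    unfolding std_ip_def by (rule sum.remove) auto
  have "norm (adj (x $ i) * x $ i) \<le> norm (std_ip x x)"
    by (rule cstar_positive_norm_mono)
       (simp_all add: eq cstar_positive_adj_mult cstar_positive_sum)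
  then show ?thesis unfolding module_norm_def norm_adj_mult by (rule real_le_rsqrt)
qed

lemma std_module_norm_convergent:
  fixes X :: "nat \<Rightarrow> 'a::unital_cstar_algebra^'n::finite"
  assumes "\<And>i. convergent (\<lambda>n. X n $ i)"
  shows "module_norm_convergent std_ip X"
proof -
  from assms obtain l where l: "\<And>i. (\<lambda>n. X n $ i) \<longlonglongrightarrow> l i"
    unfolding convergent_def by metis
  have d: "(\<lambda>n. X n $ i - l i) \<longlonglongrightarrow> 0" for i using l[of i] by (simp add: LIM_zero)
  have "(\<lambda>n. sqrt (norm (\<Sum>i\<in>UNIV. adj (X n $ i - l i) * (X n $ i - l i))))
      \<longlonglongrightarrow> sqrt (norm (\<Sum>i\<in>(UNIV::'n set). adj (0::'a) * 0))"
    by (intro tendsto_intros bounded_linear.tendsto[OF bounded_linear_adj] d)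
  then have "(\<lambda>n. module_norm std_ip (X n - (\<chi> i. l i))) \<longlonglongrightarrow> 0"
    by (simp add: module_norm_def std_ip_def)
  then show ?thesis unfolding module_norm_convergent_def by blast
qed

lemma hilbert_module_std:
  "hilbert_module std_scale std_act (std_ip :: 'a::unital_cstar_algebra^'n::finite \<Rightarrow> 'a^'n \<Rightarrow> 'a)"
proof unfold_locales
  fix X :: "nat \<Rightarrow> 'a^'n"
  assume X: "module_norm_Cauchy std_ip X"
  \<comment> \<open>Completeness is inherited coordinatewise from the algebra.\<close>
  have "Cauchy (\<lambda>n. X n $ i)" for i
  proof (rule CauchyI)
    fix e :: real assume "0 < e"
    then obtain N where "\<forall>m\<ge>N. \<forall>n\<ge>N. module_norm std_ip (X m - X n) < e"
      using X unfolding module_norm_Cauchy_def by blast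
    then show "\<exists>N. \<forall>m\<ge>N. \<forall>n\<ge>N. norm (X m $ i - X n $ i) < e"
      using norm_component_le_std[of "X _ - X _" i] by (metis le_less_trans vector_minus_component)
  qed
  then show "module_norm_convergent std_ip X"
    by (intro std_module_norm_convergent) (simp add: Cauchy_convergent)
next
  fix x :: "'a^'n"
  assume 0: "std_ip x x = 0"
  have "norm (x $ i) \<le> 0" for i
    using norm_component_le_std[of x i] by (simp add: module_norm_def 0)
  then show "x = 0" by (simp add: vec_eq_iff)
qed (simp_all add: vec_eq_iff std_scale_def std_act_def std_ip_def scaleC_add_right scaleC_add_left
    scaleC_scaleC scaleC_one algebra_simps mult_scaleC_left mult_scaleC_right sum.distrib
    sum_distrib_right adj_sum adj_mult adj_adj cstar_positive_sum cstar_positive_adj_mult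
    scaleC_sum_right)

text \<open>Pairing with the unit vector \<open>axis i 1\<close> reads off coordinate
  \<open>i\<close>, so weak convergence is already coordinatewise norm convergence.\<close>

lemma std_module_Schur:
  "module_Schur (std_ip :: 'a::unital_cstar_algebra^'n::finite \<Rightarrow> 'a^'n \<Rightarrow> 'a)"
  unfolding module_Schur_def
proof (intro allI impI std_module_norm_convergent)
  fix X :: "nat \<Rightarrow> 'a^'n" and i
  assume "tau_hat_convergent std_ip X"
  then have "convergent (\<lambda>n. std_ip (axis i 1) (X n))" by (simp add: tau_hat_convergent_def)
  moreover have "std_ip (axis i 1) x = x $ i" for x :: "'a^'n"
  proof -
    have "adj (axis i 1 $ j) * x $ j = (if j = i then x $ j else 0)" for j
      by (simp add: axis_def)
    then show ?thesis by (simp add: std_ip_def)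
  qed
  ultimately show "convergent (\<lambda>n. X n $ i)" by simp
qed

theorem corollary4p9:
  shows "(\<forall>(scale :: complex \<Rightarrow> 'v::ab_group_add \<Rightarrow> 'v)
            (act :: 'v \<Rightarrow> 'a::unital_cstar_algebra \<Rightarrow> 'v) (ip :: 'v \<Rightarrow> 'v \<Rightarrow> 'a).
            hilbert_module scale act ip \<longrightarrow> finitely_generated act \<longrightarrow> module_Schur ip)
       \<and> (hilbert_module std_scale std_act (std_ip :: 'a^'n::finite \<Rightarrow> 'a^'n \<Rightarrow> 'a)
          \<and> module_Schur (std_ip :: 'a^'n \<Rightarrow> 'a^'n \<Rightarrow> 'a))"
  using hilbert_module.finitely_generated_imp_module_Schur hilbert_module_std std_module_Schur
  by blast

end
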